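(* Let $L\subseteq E$ be a linear subspace such that $L\cap\operatorname{int}(K)\neq\emptyset$. Then $$\frac{\operatorname{Sym}(L,K)}{1+\operatorname{Sym}(L,K)}\le\sigma(L)\le\frac{\operatorname{Sym}(L,K)}{1-\operatorname{Sym}(L,K)},$$ with the convention that the right-most expression above is $+\infty$ if $\operatorname{Sym}(L,K)=1$. If there exists $e\in\operatorname{int}(K^* )$ such that $\|z\|=\langle e,z\rangle$ for all $z\in K$, then $$\frac{\operatorname{Sym}(L,K)}{1+\operatorname{Sym}(L,K)}=\sigma(L).$$
   Context: $E$ is a finite-dimensional real vector space with inner product $\langle\cdot,\cdot\rangle$, endowed with a norm $\|\cdot\|$ (possibly non-Euclidean). $K\subseteq E$ is a regular closed convex cone ($\operatorname{int}(K)\neq\emptyset$ and $K$ contains no lines), with dual cone $K^*:=\{u\in E:\langle u,x\rangle\ge 0\ \forall x\in K\}$. For $v\in K\setminus\{0\}$, $\lambda_v:E\to[-\infty,\infty)$ is $\lambda_v(x):=\max\{t: x-tv\in K\}$ (equal to $-\infty$ if no such $t$ exists). For a linear subspace $L\subseteq E$, $$\sigma(L):=\min_{v\in K,\,\|v\|=1}\ \max_{x\in L,\,\|x\|\le 1}\lambda_v(x),$$ $$\operatorname{Sym}(L,K):=\min_{v\in K,\,\|v\|\le 1}\ \max_{x\in K,\,\|x\|\le 1}\{t\ge 0: x+tv\in L\},$$ where, for each $v$, the inner maximum is the largest $t\ge 0$ such that $x+tv\in L$ for some $x\in K$ with $\|x\|\le 1$ (equal to $+\infty$ if such $t$ are unbounded,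 which happens when $v\in L$). *)

theory Defs
  imports "HOL-Analysis.Analysis"
begin

(* The type class euclidean_space supplies the inner product and the topology; the possibly
   non-Euclidean norm is a separate function N, unrelated to the class operation norm.  All norms
   on a finite-dimensional space induce the same topology, so closed and interior need no
   reference to N. *)
definition is_norm :: "('a::real_vector \<Rightarrow> real) \<Rightarrow> bool" where
  "is_norm N \<longleftrightarrow>
     (\<forall>x. 0 \<le> N x) \<and>
     (\<forall>x. N x = 0 \<longleftrightarrow> x = 0) \<and>
     (\<forall>c x. N (c *\<^sub>R x) = \<bar>c\<bar> * N x) \<and>
     (\<forall>x y. N (x + y) \<le> N x + N y)"

definition regular_cone :: "'a::euclidean_space set \<Rightarrow> bool" where
  "regular_cone K \<longleftrightarrow>
     closed K \<and> convex_cone K \<and> interior K \<noteq> {} \<and>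
     \<not> (\<exists>x d. d \<noteq> 0 \<and> (\<forall>t::real. x + t *\<^sub>R d \<in> K))"

definition dual_cone :: "'a::real_inner set \<Rightarrow> 'a set" where
  "dual_cone K = {u. \<forall>x\<in>K. 0 \<le> u \<bullet> x}"

(* Maxima and minima are taken as suprema and infima in the extended reals; in particular an empty
   maximum is -\<infinity> and an unbounded one is \<infinity>.  For a regular cone, lam_attained below
   shows that this supremum is a maximum. *)
definition lam :: "'a::real_vector set \<Rightarrow> 'a \<Rightarrow> 'a \<Rightarrow> ereal" where
  "lam K v x = (SUP t\<in>{t::real. x - t *\<^sub>R v \<in> K}. ereal t)"

definition sigma_L :: "('a::real_vector \<Rightarrow> real) \<Rightarrow> 'a set \<Rightarrow> 'a set \<Rightarrow> ereal" where
  "sigma_L N L K = (INF v\<in>{v\<in>K. N v = 1}. SUP x\<in>{x\<in>L. N x \<le> 1}. lam K v x)"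

definition Sym :: "('a::real_vector \<Rightarrow> real) \<Rightarrow> 'a set \<Rightarrow> 'a set \<Rightarrow> ereal" where
  "Sym N L K =
     (INF v\<in>{v\<in>K. N v \<le> 1}.
        SUP t\<in>{t::real. 0 \<le> t \<and> (\<exists>x\<in>K. N x \<le> 1 \<and> x + t *\<^sub>R v \<in> L)}. ereal t)"

(* For a subspace L and regular K, Sym N L K = \<infinity> exactly when L = UNIV; there s / (1 + s) and s / (1 - s) are
   indeterminate (and \<infinity> / \<infinity> = 0 in ereal).  At s = \<infinity> the first expression is
   given its limit 1; the second is given the same value \<infinity> as at s = 1. *)
definition sym_lower :: "ereal \<Rightarrow> ereal" where
  "sym_lower s = (if s = \<infinity> then 1 else s / (1 + s))"

definition sym_upper :: "ereal \<Rightarrow> ereal" where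
  "sym_upper s = (if s = 1 \<or> s = \<infinity> then \<infinity> else s / (1 - s))"

lemma lam_attained:
  fixes K :: "'a::euclidean_space set"
  assumes K: "regular_cone K" and v: "v \<in> K" "v \<noteq> 0" and ne: "\<exists>t. x - t *\<^sub>R v \<in> K"
  shows "\<exists>t. x - t *\<^sub>R v \<in> K \<and> (\<forall>s. x - s *\<^sub>R v \<in> K \<longrightarrow> s \<le> t) \<and> lam K v x = ereal t"
proof -
  define T where "T = {t. x - t *\<^sub>R v \<in> K}"
  have cl: "closed K" and cc: "convex_cone K"
    using K by (auto simp: regular_cone_def)
  have scale: "c *\<^sub>R y \<in> K" if "y \<in> K" "c \<ge> 0" for c y
    using cc that by (auto simp: convex_cone_def conic_def)
  have "T = (\<lambda>t. x - t *\<^sub>R v) -` K" by (auto simp: T_def)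
  then have clT: "closed T"
    by (auto intro!: closed_vimage cl continuous_intros)
  have bdd: "bdd_above T"
  proof (rule ccontr)
    assume nb: "\<not> bdd_above T"
    have "\<exists>t\<in>T. real n + 1 < t" for n
      using nb unfolding bdd_above_def by (meson not_le)
    then obtain f where f: "\<And>n. f n \<in> T" "\<And>n. real n + 1 < f n" by metis
    have fpos: "f n > 0" for n using f(2)[of n] by linarith
    have "filterlim f at_top sequentially"
    proof (rule filterlim_at_top_mono[OF filterlim_real_sequentially], intro always_eventually allI)
      show "real n \<le> f n" for n using f(2)[of n] by linarith
    qed
    then have "(\<lambda>n. inverse (f n)) \<longlonglongrightarrow> 0"
      by (rule tendsto_inverse_0_at_top)
    then have lim: "(\<lambda>n. inverse (f n) *\<^sub>R x - v) \<longlonglongrightarrow> 0 *\<^sub>R x - v"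
      by (intro tendsto_intros)
    have mem: "inverse (f n) *\<^sub>R x - v \<in> K" for n
    proof -
      have "inverse (f n) *\<^sub>R (x - f n *\<^sub>R v) \<in> K"
        using f(1)[of n] fpos[of n] by (intro scale) (auto simp: T_def)
      then show ?thesis using fpos[of n] by (simp add: scaleR_diff_right)
    qed
    have mv: "- v \<in> K"
      using closed_sequentially[OF cl mem lim] by simp
    have "0 + t *\<^sub>R v \<in> K" for t
      using scale[OF v(1), of t] scale[OF mv, of "- t"] by (cases "t \<ge> 0") auto
    then show False using K v(2) unfolding regular_cone_def by blast
  qed
  have neT: "T \<noteq> {}" using ne by (auto simp: T_def)
  have in_T: "Sup T \<in> T" by (rule closed_contains_Sup[OF neT bdd clT])
  have ub: "s \<le> Sup T" if "s \<in> T" for s by (rule cSup_upper[OF that bdd])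
  have "lam K v x = ereal (Sup T)"
    unfolding lam_def T_def[symmetric]
    by (rule antisym) (use in_T ub in \<open>auto intro!: SUP_least SUP_upper\<close>)
  then show ?thesis using in_T ub by (auto simp: T_def)
qed

end

theory Submission
  imports Defs
begin

text \<open>
  A point \<open>x \<in> L\<close> with \<open>x - t v \<in> K\<close> and a point \<open>z \<in> K\<close> with \<open>z + t v \<in> L\<close> are the same data
  under \<open>z = x - t v\<close>; only the normalisation differs. Passing from \<open>z\<close> to \<open>x\<close> multiplies the
  norm bound by at most \<open>1 + t\<close>, and so does passing from \<open>x\<close> to \<open>z\<close>, which gives the two
  inequalities. If the norm is linear on \<open>K\<close>, the bound for the second passage improves from
  \<open>1 + t\<close> to \<open>1 - t\<close>, which gives equality. The upper bound also needs \<open>Sym \<le> 1\<close> for proper \<open>L\<close>: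
  if \<open>x + t v \<in> L\<close> and \<open>a\<close> is normal to \<open>L\<close>, then \<open>|a \<bullet> x| = t |a \<bullet> v|\<close>, so \<open>t > 1\<close> cannot be
  available uniformly while \<open>|a \<bullet> v|\<close> stays bounded on the unit ball.
\<close>

section \<open>Non-Euclidean norms on a Euclidean space\<close>

lemma is_normD:
  assumes "is_norm N"
  shows is_norm_nonneg: "0 \<le> N x"
    and is_norm_eq_0_iff: "N x = 0 \<longleftrightarrow> x = 0"
    and is_norm_scaleR: "N (c *\<^sub>R x) = \<bar>c\<bar> * N x"
    and is_norm_triangle: "N (x + y) \<le> N x + N y"
  using assms by (auto simp: is_norm_def)

lemma is_norm_zero: "is_norm N \<Longrightarrow> N 0 = 0"
  by (simp add: is_norm_eq_0_iff)

lemma is_norm_pos: "is_norm N \<Longrightarrow> x \<noteq> 0 \<Longrightarrow> 0 < N x"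
  using is_norm_nonneg[of N x] is_norm_eq_0_iff[of N x] by linarith

lemma is_norm_triangle_diff:
  assumes "is_norm N"
  shows "N (x - y) \<le> N x + N y"
  using is_norm_triangle[OF assms, of x "- y"] is_norm_scaleR[OF assms, of "-1" y] by simp

text \<open>Expanding in \<open>Basis\<close> bounds \<open>N\<close> by a multiple \<open>B\<close>
  of the Euclidean norm; the triangle inequality then makes \<open>N\<close> Lipschitz with constant
  \<open>B\<close>.\<close>

lemma is_norm_continuous_on:
  fixes N :: "'a::euclidean_space \<Rightarrow> real"
  assumes N: "is_norm N"
  shows "continuous_on S N"
proof -
  define B where "B = (\<Sum>b\<in>Basis. N b)"
  have B0: "0 \<le> B"
    unfolding B_def by (intro sum_nonneg is_norm_nonneg[OF N])
  have le: "N x \<le> B * norm x" for x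
  proof -
    have "N (\<Sum>b\<in>A. (x \<bullet> b) *\<^sub>R b) \<le> (\<Sum>b\<in>A. \<bar>x \<bullet> b\<bar> * N b)" if "finite A" for A
      using that
    proof induction
      case (insert b A)
      then show ?case
        using is_norm_triangle[OF N, of "(x \<bullet> b) *\<^sub>R b" "\<Sum>b\<in>A. (x \<bullet> b) *\<^sub>R b"]
        by (simp add: is_norm_scaleR[OF N])
    qed (simp add: is_norm_zero[OF N])
    from this[of Basis] have "N x \<le> (\<Sum>b\<in>Basis. \<bar>x \<bullet> b\<bar> * N b)"
      by (simp add: euclidean_representation)
    also have "\<dots> \<le> (\<Sum>b\<in>Basis. norm x * N b)"
      by (intro sum_mono mult_right_mono Basis_le_norm is_norm_nonneg[OF N])
    finally show ?thesis
      by (simp add: B_def sum_distrib_left mult.commute)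
  qed
  have "\<bar>N x - N y\<bar> \<le> B * norm (x - y)" for x y
    using is_norm_triangle[OF N, of "x - y" y] is_norm_triangle[OF N, of "y - x" x]
      le[of "x - y"] le[of "y - x"] by (simp add: norm_minus_commute)
  then have "B-lipschitz_on S N"
    by (auto intro!: lipschitz_onI B0 simp: dist_norm)
  then show ?thesis
    by (rule lipschitz_on_continuous_on)
qed

text \<open>By compactness \<open>N\<close> attains a positive minimum on the Euclidean unit sphere;
  its inverse serves as \<open>C\<close>.\<close>

lemma norm_le_is_norm:
  fixes N :: "'a::euclidean_space \<Rightarrow> real"
  assumes N: "is_norm N"
  obtains C where "C > 0" "\<And>x. norm x \<le> C * N x"
proof -
  have "sphere (0::'a) 1 \<noteq> {}"
    by simp
  then obtain y :: 'a where y: "norm y = 1" and min: "\<And>x. norm x = 1 \<Longrightarrow> N y \<le> N x"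
    using continuous_attains_inf[OF compact_sphere _ is_norm_continuous_on[OF N], of 0 1] by auto
  have Ny: "0 < N y"
    using y by (intro is_norm_pos[OF N]) auto
  have "norm x \<le> inverse (N y) * N x" for x
  proof (cases "x = 0")
    case False
    have "N y \<le> inverse (norm x) * N x"
      using min[of "inverse (norm x) *\<^sub>R x"] False by (simp add: is_norm_scaleR[OF N])
    then show ?thesis
      using False Ny by (simp add: field_simps)
  qed (simp add: is_norm_zero[OF N])
  with Ny show thesis
    by (intro that[of "inverse (N y)"]) auto
qed

section \<open>The cone and the range of \<open>Sym\<close>\<close>

lemma regular_cone_convex_cone: "regular_cone K \<Longrightarrow> convex_cone K"
  by (simp add: regular_cone_def)

lemma regular_cone_unit_vector:
  assumes "is_norm N" "regular_cone K" "v \<in> K" "v \<noteq> 0"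
  shows "inverse (N v) *\<^sub>R v \<in> K" "N (inverse (N v) *\<^sub>R v) = 1"
  using assms is_norm_pos[of N v]
  by (auto simp: is_norm_scaleR intro!: convex_cone_scaleR regular_cone_convex_cone)

lemma less_Sym_obtains:
  assumes "ereal c < Sym N L K" "v \<in> K" "N v \<le> 1"
  obtains t x where "c < t" "0 \<le> t" "x \<in> K" "N x \<le> 1" "x + t *\<^sub>R v \<in> L"
proof -
  have "ereal c < (SUP t\<in>{t::real. 0 \<le> t \<and> (\<exists>x\<in>K. N x \<le> 1 \<and> x + t *\<^sub>R v \<in> L)}. ereal t)"
    using assms(1) by (rule less_le_trans) (auto simp: Sym_def intro!: INF_lower assms)
  then show thesis
    using that by (auto simp: less_SUP_iff)
qed

text \<open>\<open>Sym\<close> minimises over the unit ball but \<open>sigma_L\<close> over the unit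
  sphere. Normalising \<open>v\<close> shrinks the feasible values of \<open>t\<close> by the factor
  \<open>N v\<close>, which is at most 1, so a bound for \<open>v\<close> survives on the
  sphere.\<close>

lemma Sym_less_obtains:
  assumes N: "is_norm N" and K: "regular_cone K" and L: "subspace L"
    and c: "Sym N L K < ereal c"
  obtains v where "v \<in> K" "N v = 1"
    "\<And>t x. 0 \<le> t \<Longrightarrow> x \<in> K \<Longrightarrow> N x \<le> 1 \<Longrightarrow> x + t *\<^sub>R v \<in> L \<Longrightarrow> t < c"
proof -
  from c obtain v where v: "v \<in> K" "N v \<le> 1"
    and sup: "(SUP t\<in>{t::real. 0 \<le> t \<and> (\<exists>x\<in>K. N x \<le> 1 \<and> x + t *\<^sub>R v \<in> L)}. ereal t) < ereal c"
    by (auto simp: Sym_def INF_less_iff)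
  have lt: "t < c" if "0 \<le> t" "x \<in> K" "N x \<le> 1" "x + t *\<^sub>R v \<in> L" for t x
  proof -
    have "ereal t \<le> (SUP t\<in>{t::real. 0 \<le> t \<and> (\<exists>x\<in>K. N x \<le> 1 \<and> x + t *\<^sub>R v \<in> L)}. ereal t)"
      by (intro SUP_upper) (use that in auto)
    with sup have "ereal t < ereal c"
      by (rule le_less_trans[rotated])
    then show ?thesis
      by simp
  qed
  have K0: "0 \<in> K"
    using regular_cone_convex_cone[OF K] by (rule convex_cone_contains_0)
  \<comment> \<open>For \<open>v = 0\<close> the point 0 makes every nonnegative \<open>t\<close>
    feasible, even \<open>max c 0\<close>.\<close>
  have "v \<noteq> 0"
    using lt[of "max c 0" 0] K0 subspace_0[OF L] by (auto simp: is_norm_zero[OF N])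
  then have Nv: "0 < N v"
    by (rule is_norm_pos[OF N])
  show thesis
  proof (rule that)
    show "inverse (N v) *\<^sub>R v \<in> K" "N (inverse (N v) *\<^sub>R v) = 1"
      using regular_cone_unit_vector[OF N K v(1) \<open>v \<noteq> 0\<close>] .
    fix t x assume t: "0 \<le> t" "x \<in> K" "N x \<le> 1" "x + t *\<^sub>R inverse (N v) *\<^sub>R v \<in> L"
    then have "t / N v < c"
      using Nv by (intro lt[of _ x]) (auto simp: divide_inverse)
    moreover have "t \<le> t / N v"
      using Nv v t by (simp add: field_simps mult_left_le)
    ultimately show "t < c"
      by simp
  qed
qed

lemma Sym_nonneg:
  assumes "is_norm N" "regular_cone K" "subspace L"
  shows "0 \<le> Sym N L K"
  unfolding Sym_def
proof (intro INF_greatest SUP_upper2[of 0])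
  have "0 \<in> K"
    using regular_cone_convex_cone[OF assms(2)] by (rule convex_cone_contains_0)
  then show "0 \<in> {t. 0 \<le> t \<and> (\<exists>x\<in>K. N x \<le> 1 \<and> x + t *\<^sub>R v \<in> L)}" for v
    using assms by (auto simp: is_norm_zero subspace_0 intro!: bexI[of _ 0])
qed simp

text \<open>The point 0 makes every nonnegative \<open>t\<close> feasible. Hence a finite
  \<open>sym_upper\<close> forces \<open>L\<close> to be proper, as \<open>Sym_le_1\<close>
  requires.\<close>

lemma Sym_UNIV:
  assumes N: "is_norm N" and K: "regular_cone K"
  shows "Sym N UNIV K = \<infinity>"
proof (rule ereal_top)
  fix c :: real
  show "ereal c \<le> Sym N UNIV K"
  proof (rule ccontr)
    assume "\<not> ?thesis"
    then have "Sym N UNIV K < ereal c"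
      by simp
    then obtain v where "\<And>t x. 0 \<le> t \<Longrightarrow> x \<in> K \<Longrightarrow> N x \<le> 1 \<Longrightarrow> x + t *\<^sub>R v \<in> UNIV \<Longrightarrow> t < c"
      by (rule Sym_less_obtains[OF N K subspace_UNIV]) blast
    from this[of "max c 0" 0] show False
      using convex_cone_contains_0[OF regular_cone_convex_cone[OF K]] is_norm_zero[OF N] by simp
  qed
qed

lemma Sym_le_1:
  fixes L :: "'a::euclidean_space set"
  assumes N: "is_norm N" and K: "regular_cone K" and L: "subspace L" and "L \<noteq> UNIV"
  shows "Sym N L K \<le> 1"
proof (rule ccontr)
  assume "\<not> ?thesis"
  then obtain r where r: "1 < r" "ereal r < Sym N L K"
    using ereal_dense2[of 1 "Sym N L K"] by (auto simp: one_ereal_def not_le)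
  have "span L \<subset> span UNIV"
    using L \<open>L \<noteq> UNIV\<close> by (metis span_eq_iff span_UNIV top.not_eq_extremum)
  then obtain a where a: "a \<noteq> 0" and "\<And>y. y \<in> span L \<Longrightarrow> orthogonal a y"
    by (rule orthogonal_to_subspace_exists_gen) blast
  then have aL: "a \<bullet> y = 0" if "y \<in> L" for y
    using that by (auto simp: orthogonal_def span_base)
  obtain C where C: "C > 0" "\<And>x. norm x \<le> C * N x"
    using norm_le_is_norm[OF N] by blast
  define V where "V = {v\<in>K. N v \<le> 1}"
  \<comment> \<open>The largest size of \<open>a\<close> on the cone part of the unit ball. A
    feasible \<open>t > r\<close> for every \<open>v\<close> will give \<open>D \<le> D / r\<close>,
    absurd once \<open>0 < D\<close>.\<close>
  define D where "D = (SUP v\<in>V. \<bar>a \<bullet> v\<bar>)"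
  have "\<bar>a \<bullet> v\<bar> \<le> norm a * C" if "v \<in> V" for v
  proof -
    have "C * N v \<le> C"
      using that C(1) by (auto simp: V_def)
    then have "norm v \<le> C"
      using C(2)[of v] by linarith
    then have "norm a * norm v \<le> norm a * C"
      by (rule mult_left_mono) simp
    then show ?thesis
      using Cauchy_Schwarz_ineq2[of a v] by linarith
  qed
  then have bdd: "bdd_above ((\<lambda>v. \<bar>a \<bullet> v\<bar>) ` V)"
    by (intro bdd_aboveI2)
  have upper: "\<bar>a \<bullet> v\<bar> \<le> D" if "v \<in> V" for v
    unfolding D_def using that bdd by (rule cSUP_upper)
  \<comment> \<open>A hyperplane has empty interior, so it cannot contain \<open>K\<close>; this
    makes \<open>D\<close> positive.\<close>
  have "\<not> K \<subseteq> {x. a \<bullet> x = 0}"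
    using K a interior_mono[of K "{x. a \<bullet> x = 0}"] by (auto simp: regular_cone_def)
  then obtain w where w: "w \<in> K" "a \<bullet> w \<noteq> 0"
    by blast
  then have "w \<noteq> 0"
    by auto
  note w' = regular_cone_unit_vector[OF N K w(1) this]
  then have wV: "inverse (N w) *\<^sub>R w \<in> V"
    by (simp add: V_def)
  have "0 < \<bar>a \<bullet> (inverse (N w) *\<^sub>R w)\<bar>"
    using w is_norm_pos[OF N \<open>w \<noteq> 0\<close>] by simp
  then have "0 < D"
    using upper[OF wV] by linarith
  have "\<bar>a \<bullet> v\<bar> \<le> D / r" if v: "v \<in> V" for v
  proof -
    from v obtain t x where t: "r < t" "0 \<le> t" "x \<in> K" "N x \<le> 1" "x + t *\<^sub>R v \<in> L"
      using less_Sym_obtains[OF r(2), of v] by (auto simp: V_def)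
    then have "a \<bullet> x = - (t * (a \<bullet> v))"
      using aL[OF t(5)] by (simp add: inner_add_right)
    then have "\<bar>a \<bullet> x\<bar> = t * \<bar>a \<bullet> v\<bar>"
      using t by (simp add: abs_mult)
    moreover have "r * \<bar>a \<bullet> v\<bar> \<le> t * \<bar>a \<bullet> v\<bar>"
      using t by (intro mult_right_mono) auto
    moreover have "\<bar>a \<bullet> x\<bar> \<le> D"
      using t by (intro upper) (simp add: V_def)
    ultimately show ?thesis
      using r by (simp add: field_simps)
  qed
  then have "D \<le> D / r"
    unfolding D_def using wV by (intro cSUP_least) auto
  then show False
    using \<open>0 < D\<close> r by (simp add: field_simps)
qed

section \<open>Bounding \<open>sigma_L\<close> through feasible points, and arithmetic of the two
  fractions\<close>

lemma sigma_L_leI: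
  assumes "v \<in> K" "N v = 1"
    and "\<And>x t. x \<in> L \<Longrightarrow> N x \<le> 1 \<Longrightarrow> x - t *\<^sub>R v \<in> K \<Longrightarrow> t \<le> c"
  shows "sigma_L N L K \<le> ereal c"
proof -
  have "(SUP x\<in>{x\<in>L. N x \<le> 1}. lam K v x) \<le> ereal c"
    using assms(3) by (auto simp: lam_def intro!: SUP_least)
  moreover have "sigma_L N L K \<le> (SUP x\<in>{x\<in>L. N x \<le> 1}. lam K v x)"
    unfolding sigma_L_def using assms by (intro INF_lower) auto
  ultimately show ?thesis
    by (rule order_trans[rotated])
qed

lemma le_sigma_LI:
  assumes "\<And>v. v \<in> K \<Longrightarrow> N v = 1 \<Longrightarrow> \<exists>x\<in>L. \<exists>t\<ge>c. N x \<le> 1 \<and> x - t *\<^sub>R v \<in> K"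
  shows "ereal c \<le> sigma_L N L K"
  unfolding sigma_L_def
proof (rule INF_greatest)
  fix v assume "v \<in> {v\<in>K. N v = 1}"
  then obtain x t where x: "x \<in> L" "t \<ge> c" "N x \<le> 1" "x - t *\<^sub>R v \<in> K"
    using assms by blast
  then have "ereal c \<le> lam K v x"
    unfolding lam_def by (intro SUP_upper2[of t]) auto
  also have "\<dots> \<le> (SUP x\<in>{x\<in>L. N x \<le> 1}. lam K v x)"
    using x by (intro SUP_upper) auto
  finally show "ereal c \<le> (SUP x\<in>{x\<in>L. N x \<le> 1}. lam K v x)" .
qed

lemma sym_lower_ereal: "0 \<le> s \<Longrightarrow> sym_lower (ereal s) = ereal (s / (1 + s))"
  by (simp add: sym_lower_def one_ereal_def)

lemma sym_upper_ereal: "s \<noteq> 1 \<Longrightarrow> sym_upper (ereal s) = ereal (s / (1 - s))"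
  by (simp add: sym_upper_def one_ereal_def)

text \<open>The map c/(1 - c) inverts s/(1 + s). At \<open>s = \<infinity>\<close> both sides hold,
  because \<open>sym_lower\<close> is 1 there.\<close>

lemma less_sym_lower_iff:
  assumes "0 \<le> s" "c < 1"
  shows "ereal c < sym_lower s \<longleftrightarrow> ereal (c / (1 - c)) < s"
  using assms
  by (cases s) (auto simp: sym_lower_ereal sym_lower_def one_ereal_def field_simps)

lemma sym_lower_less_iff:
  assumes "0 \<le> s" "c < 1"
  shows "sym_lower s < ereal c \<longleftrightarrow> s < ereal (c / (1 - c))"
  using assms
  by (cases s) (auto simp: sym_lower_ereal sym_lower_def one_ereal_def field_simps)

lemma sym_lower_bounds:
  assumes "0 \<le> s"
  shows "0 \<le> sym_lower s" "sym_lower s \<le> 1"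
  using assms by (cases s; auto simp: sym_lower_ereal sym_lower_def one_ereal_def)+

text \<open>Comparing through real thresholds gives the strict slack that yields witnesses for
  suprema and infima without attainment.\<close>

lemma ereal_le_reals_below:
  fixes x y :: ereal
  assumes "\<And>c. ereal c < x \<Longrightarrow> ereal c \<le> y"
  shows "x \<le> y"
  using assms ereal_dense2[of y x] by (meson leD leI)

lemma ereal_le_reals_above:
  fixes x y :: ereal
  assumes "\<And>c. y < ereal c \<Longrightarrow> x \<le> ereal c"
  shows "x \<le> y"
  using assms ereal_dense2[of y x] by (meson leD leI)

section \<open>The lower bound on \<open>sigma_L\<close>\<close>

lemma sym_lower_le_sigma_L:
  assumes N: "is_norm N" and K: "regular_cone K" and L: "subspace L"
  shows "sym_lower (Sym N L K) \<le> sigma_L N L K"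
proof (rule ereal_le_reals_below, rule le_sigma_LI)
  note cone = regular_cone_convex_cone[OF K]
  note s0 = Sym_nonneg[OF N K L]
  fix c v assume c: "ereal c < sym_lower (Sym N L K)" and v: "v \<in> K" "N v = 1"
  have "ereal c < 1"
    using c sym_lower_bounds(2)[OF s0] by (rule less_le_trans)
  then have c1: "c < 1"
    by simp
  then have "ereal (c / (1 - c)) < Sym N L K"
    using c s0 by (simp add: less_sym_lower_iff)
  then obtain t x where t: "c / (1 - c) < t" "0 \<le> t" "x \<in> K" "N x \<le> 1" "x + t *\<^sub>R v \<in> L"
    using v by (auto elim: less_Sym_obtains)
  \<comment> \<open>Dividing by \<open>1 + t\<close> brings the point of \<open>L\<close> into the
    unit ball; it turns the coefficient of \<open>v\<close> into \<open>t / (1 + t)\<close>, which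
    exceeds \<open>c\<close>.\<close>
  define y where "y = inverse (1 + t) *\<^sub>R (x + t *\<^sub>R v)"
  have "N (x + t *\<^sub>R v) \<le> 1 + t"
    using is_norm_triangle[OF N, of x "t *\<^sub>R v"] t v by (simp add: is_norm_scaleR[OF N])
  then have "N y \<le> 1"
    unfolding y_def is_norm_scaleR[OF N] using t by (simp add: field_simps)
  moreover have "y \<in> L"
    unfolding y_def using L t by (intro subspace_scale)
  moreover have "c \<le> t / (1 + t)"
    using t c1 by (simp add: field_simps)
  moreover have "y - (t / (1 + t)) *\<^sub>R v = inverse (1 + t) *\<^sub>R x"
    by (simp add: y_def scaleR_add_right divide_inverse mult.commute)
  then have "y - (t / (1 + t)) *\<^sub>R v \<in> K"
    using t by (auto intro: convex_cone_scaleR[OF cone])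
  ultimately show "\<exists>x\<in>L. \<exists>t\<ge>c. N x \<le> 1 \<and> x - t *\<^sub>R v \<in> K"
    by blast
qed

section \<open>The upper bounds on \<open>sigma_L\<close>\<close>

text \<open>
  Common core of both upper bounds: \<open>\<beta>\<close> bounds the norm of \<open>x - t v\<close> and is \<open>1 + t\<close> for a general
  norm, \<open>1 - t\<close> for a norm that is linear on \<open>K\<close>.
\<close>

lemma feasible_rescale:
  assumes N: "is_norm N" and K: "regular_cone K" and L: "subspace L"
    and v: "\<And>t x. 0 \<le> t \<Longrightarrow> x \<in> K \<Longrightarrow> N x \<le> 1 \<Longrightarrow> x + t *\<^sub>R v \<in> L \<Longrightarrow> t < d"
    and x: "x \<in> L" "x - t *\<^sub>R v \<in> K" "N (x - t *\<^sub>R v) \<le> \<beta>" "0 < \<beta>" "0 \<le> t"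
  shows "t / \<beta> < d"
proof (rule v)
  show "0 \<le> t / \<beta>"
    using x by simp
  show "N (inverse \<beta> *\<^sub>R (x - t *\<^sub>R v)) \<le> 1"
    unfolding is_norm_scaleR[OF N] using x by (simp add: field_simps)
  show "inverse \<beta> *\<^sub>R (x - t *\<^sub>R v) \<in> K"
    using x by (intro convex_cone_scaleR[OF regular_cone_convex_cone[OF K]]) auto
  have "inverse \<beta> *\<^sub>R (x - t *\<^sub>R v) + (t / \<beta>) *\<^sub>R v = inverse \<beta> *\<^sub>R x"
    by (simp add: scaleR_diff_right divide_inverse mult.commute)
  then show "inverse \<beta> *\<^sub>R (x - t *\<^sub>R v) + (t / \<beta>) *\<^sub>R v \<in> L"
    using subspace_scale[OF L x(1)] by simp
qed

lemma sigma_L_le_sym_upper: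
  assumes N: "is_norm N" and K: "regular_cone K" and L: "subspace L"
  shows "sigma_L N L K \<le> sym_upper (Sym N L K)"
proof (cases "sym_upper (Sym N L K) = \<infinity>")
  case False
  then have "L \<noteq> UNIV"
    using Sym_UNIV[OF N K] by (auto simp: sym_upper_def)
  with False have "Sym N L K < 1"
    using Sym_le_1[OF N K L] by (auto simp: sym_upper_def order_less_le)
  then obtain s where s: "Sym N L K = ereal s" "0 \<le> s" "s < 1"
    using Sym_nonneg[OF N K L] by (cases "Sym N L K") auto
  show ?thesis
  proof (rule ereal_le_reals_above)
    fix c assume "sym_upper (Sym N L K) < ereal c"
    then have c: "s / (1 - s) < c"
      using s by (simp add: sym_upper_ereal)
    moreover have "0 \<le> s / (1 - s)"
      using s by simp
    ultimately have "0 < c"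
      by linarith
    \<comment> \<open>c/(1 + c) inverts s/(1 - s), and by monotonicity t/(1 + t) < c/(1 + c) will
      force \<open>t < c\<close>.\<close>
    then have "Sym N L K < ereal (c / (1 + c))"
      using s c by (simp add: field_simps)
    then obtain v where v: "v \<in> K" "N v = 1"
      and less: "\<And>t x. 0 \<le> t \<Longrightarrow> x \<in> K \<Longrightarrow> N x \<le> 1 \<Longrightarrow> x + t *\<^sub>R v \<in> L \<Longrightarrow> t < c / (1 + c)"
      by (rule Sym_less_obtains[OF N K L]) blast
    from v show "sigma_L N L K \<le> ereal c"
    proof (rule sigma_L_leI)
      fix x t assume x: "x \<in> L" "N x \<le> 1" "x - t *\<^sub>R v \<in> K"
      show "t \<le> c"
      proof (rule ccontr)
        assume "\<not> t \<le> c"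
        with \<open>0 < c\<close> have t: "c < t" "0 < t"
          by auto
        have le: "N (x - t *\<^sub>R v) \<le> 1 + t"
          using is_norm_triangle_diff[OF N, of x "t *\<^sub>R v"] x v t by (simp add: is_norm_scaleR[OF N])
        have "t / (1 + t) < c / (1 + c)"
          by (rule feasible_rescale[OF N K L less x(1,3) le]) (use t in auto)
        then show False
          using t \<open>0 < c\<close> by (simp add: field_simps)
      qed
    qed
  qed
qed simp

lemma sigma_L_le_sym_lower:
  assumes N: "is_norm N" and K: "regular_cone K" and L: "subspace L"
    and e: "\<forall>z\<in>K. N z = e \<bullet> z"
  shows "sigma_L N L K \<le> sym_lower (Sym N L K)"
proof (rule ereal_le_reals_above)
  note cone = regular_cone_convex_cone[OF K]
  note s0 = Sym_nonneg[OF N K L]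
  \<comment> \<open>Since \<open>t\<close> is nonnegative, \<open>x\<close> is a sum of two elements
    of \<open>K\<close>. Thus \<open>N\<close> acts linearly on \<open>x\<close>, \<open>v\<close>
    and \<open>x - t v\<close>, and subtracting \<open>t v\<close> lowers the norm by exactly
    \<open>t\<close>.\<close>
  have norm_diff: "N (x - t *\<^sub>R v) \<le> 1 - t"
    if "v \<in> K" "N v = 1" "N x \<le> 1" "x - t *\<^sub>R v \<in> K" "0 \<le> t" for x v t
  proof -
    have "(x - t *\<^sub>R v) + t *\<^sub>R v \<in> K"
      using that by (intro convex_cone_add[OF cone] convex_cone_scaleR[OF cone])
    then have "N x = e \<bullet> x"
      using e by simp
    moreover have "N (x - t *\<^sub>R v) = e \<bullet> x - t * N v"
      using e that by (simp add: inner_diff_right)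
    ultimately show ?thesis
      using that by simp
  qed
  fix c assume c: "sym_lower (Sym N L K) < ereal c"
  with sym_lower_bounds(1)[OF s0] have "0 < ereal c"
    by (rule le_less_trans)
  then have "0 < c"
    by simp
  show "sigma_L N L K \<le> ereal c"
  proof (cases "c < 1")
    case True
    then have "Sym N L K < ereal (c / (1 - c))"
      using c s0 by (simp add: sym_lower_less_iff)
    then obtain v where v: "v \<in> K" "N v = 1"
      and less: "\<And>t x. 0 \<le> t \<Longrightarrow> x \<in> K \<Longrightarrow> N x \<le> 1 \<Longrightarrow> x + t *\<^sub>R v \<in> L \<Longrightarrow> t < c / (1 - c)"
      by (rule Sym_less_obtains[OF N K L]) blast
    from v show ?thesis
    proof (rule sigma_L_leI)
      fix x t assume x: "x \<in> L" "N x \<le> 1" "x - t *\<^sub>R v \<in> K"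
      show "t \<le> c"
      proof (rule ccontr)
        assume "\<not> t \<le> c"
        with \<open>0 < c\<close> have t: "c < t" "0 < t"
          by auto
        have le: "N (x - t *\<^sub>R v) \<le> 1 - t"
          using x v t by (intro norm_diff) auto
        show False
        \<comment> \<open>Rescaling divides by \<open>1 - t\<close>. For \<open>t \<ge> 1\<close>
          the bound forces \<open>x = t v\<close>, so \<open>v\<close> lies in \<open>L\<close> and
          the point 0 makes the excluded value \<open>c / (1 - c)\<close> feasible.\<close>
        proof (cases "t < 1")
          case True
          have "t / (1 - t) < c / (1 - c)"
            by (rule feasible_rescale[OF N K L less x(1,3) le]) (use t True in auto)
          then show False
            using t True \<open>c < 1\<close> by (simp add: field_simps)
        next
          case False
          then have "N (x - t *\<^sub>R v) = 0"
            using le is_norm_nonneg[OF N, of "x - t *\<^sub>R v"] by linarith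
          then have "x = t *\<^sub>R v"
            by (simp add: is_norm_eq_0_iff[OF N])
          then have "v \<in> L"
            using subspace_scale[OF L x(1), of "inverse t"] t by simp
          then have "0 + (c / (1 - c)) *\<^sub>R v \<in> L"
            using subspace_scale[OF L] by simp
          then show False
            using less[of "c / (1 - c)" 0] \<open>0 < c\<close> \<open>c < 1\<close> convex_cone_contains_0[OF cone]
            by (simp add: is_norm_zero[OF N])
        qed
      qed
    qed
  next
    \<comment> \<open>Here any unit vector of \<open>K\<close> works: \<open>norm_diff\<close> gives
      \<open>0 \<le> 1 - t\<close>, hence \<open>t \<le> 1 \<le> c\<close>.\<close>
    case False
    obtain w where w: "w \<in> K" "w \<noteq> 0"
    proof -
      have "\<not> K \<subseteq> {0}"
        using K interior_mono[of K "{0}"] by (auto simp: regular_cone_def)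
      then show thesis
        using that by blast
    qed
    note w' = regular_cone_unit_vector[OF N K w]
    from w' show ?thesis
    proof (rule sigma_L_leI)
      fix x t assume x: "N x \<le> 1" "x - t *\<^sub>R inverse (N w) *\<^sub>R w \<in> K"
      show "t \<le> c"
      proof (cases "0 \<le> t")
        case True
        then show ?thesis
          using norm_diff[OF w' x True] is_norm_nonneg[OF N, of "x - t *\<^sub>R inverse (N w) *\<^sub>R w"] False
          by linarith
      qed (use \<open>0 < c\<close> in simp)
    qed
  qed
qed

theorem theorem2:
  fixes N :: "'a::euclidean_space \<Rightarrow> real" and K L :: "'a set"
  assumes "is_norm N" and "regular_cone K"
    and "subspace L" and "L \<inter> interior K \<noteq> {}"
  shows "sym_lower (Sym N L K) \<le> sigma_L N L K \<and>
         sigma_L N L K \<le> sym_upper (Sym N L K) \<and>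
         ((\<exists>e\<in>interior (dual_cone K). \<forall>z\<in>K. N z = e \<bullet> z) \<longrightarrow>
            sym_lower (Sym N L K) = sigma_L N L K)"
  using sym_lower_le_sigma_L[OF assms(1-3)] sigma_L_le_sym_upper[OF assms(1-3)]
    sigma_L_le_sym_lower[OF assms(1-3)] by (blast intro: antisym)

end
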